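(* In Version A, played on any finite number of piles of tokens, a position is a $\mathcal{P}$-position if and only if every pile has an even number of tokens.
   Context: Version A is the following two-player impartial game. A position consists of finitely many piles of tokens (sizes are nonnegative integers). The players alternate turns; on a turn, the player selects any nonempty set of nonempty piles and removes exactly one token from each selected pile. The last player to move wins (a player with no legal move loses). A position is a $\mathcal{P}$-position if the player who is not about to move (the previous player) has a winning strategy, equivalently if none of its options is a $\mathcal{P}$-position; otherwise it is an $\mathcal{N}$-position. An option of a position is a position reachable from it in one move. *)

theory Defs
  imports Main
begin

text \<open>
  A position is the list of its pile sizes; the empty list is the game with no piles. Piles that
  have become empty stay in the list.
\<close>
type_synonym position = "nat list"

text \<open>\<open>S\<close> is the set of (indices of) piles from which the player removes one token each.\<close>
definition is_option :: "position \<Rightarrow> position \<Rightarrow> bool" where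
  "is_option p q \<longleftrightarrow>
     (\<exists>S. S \<noteq> {} \<and> S \<subseteq> {i. i < length p \<and> p ! i > 0} \<and>
          q = map (\<lambda>i. if i \<in> S then p ! i - 1 else p ! i) [0..<length p])"

definition terminal :: "position \<Rightarrow> bool" where
  "terminal p \<longleftrightarrow> (\<nexists>q. is_option p q)"

text \<open>
  A complete play from \<open>p\<close>, listed as the sequence of positions passed through. Every move decreases
  the total number of tokens, so all plays are finite and lists suffice.
\<close>
definition complete_play :: "position \<Rightarrow> position list \<Rightarrow> bool" where
  "complete_play p ps \<longleftrightarrow>
     ps \<noteq> [] \<and> hd ps = p \<and>
     (\<forall>i. Suc i < length ps \<longrightarrow> is_option (ps ! i) (ps ! Suc i)) \<and>
     terminal (last ps)"

text \<open>
  A strategy chooses a legal move at every position that has one. Strategies are positional, that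
  is, independent of the earlier course of the play.
\<close>
definition strategy :: "(position \<Rightarrow> position) \<Rightarrow> bool" where
  "strategy \<sigma> \<longleftrightarrow> (\<forall>p. \<not> terminal p \<longrightarrow> is_option p (\<sigma> p))"

text \<open>
  In a play starting at \<open>ps ! 0\<close>, the player about to move at the start moves from \<open>ps ! i\<close> for even
  \<open>i\<close>, the previous player for odd \<open>i\<close>.
\<close>
definition previous_follows :: "(position \<Rightarrow> position) \<Rightarrow> position list \<Rightarrow> bool" where
  "previous_follows \<sigma> ps \<longleftrightarrow>
     (\<forall>i. odd i \<and> Suc i < length ps \<longrightarrow> ps ! Suc i = \<sigma> (ps ! i))"

text \<open>
  The play has \<open>length ps - 1\<close> moves. The previous player wins iff this number is even: either there
  is no move at all and the opponent is stuck, or the last move is a move of the previous player.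
\<close>
definition previous_wins :: "position list \<Rightarrow> bool" where
  "previous_wins ps \<longleftrightarrow> even (length ps - 1)"

definition P_position :: "position \<Rightarrow> bool" where
  "P_position p \<longleftrightarrow>
     (\<exists>\<sigma>. strategy \<sigma> \<and>
          (\<forall>ps. complete_play p ps \<and> previous_follows \<sigma> ps \<longrightarrow> previous_wins ps))"

lemma is_option_sum_list_less:
  assumes "is_option p q"
  shows "sum_list q < sum_list p"
proof -
  from assms obtain S where S: "S \<noteq> {}" "S \<subseteq> {i. i < length p \<and> p ! i > 0}"
    and q: "q = map (\<lambda>i. if i \<in> S then p ! i - 1 else p ! i) [0..<length p]"
    unfolding is_option_def by blast
  have "sum_list q = (\<Sum>i<length p. if i \<in> S then p ! i - 1 else p ! i)"
    by (auto simp: q sum_list_sum_nth atLeast0LessThan intro!: sum.cong)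
  also have "\<dots> < (\<Sum>i<length p. p ! i)"
  proof (rule sum_strict_mono_ex1)
    from S obtain i where "i \<in> S" "i < length p" "p ! i > 0" by blast
    then show "\<exists>i\<in>{..<length p}. (if i \<in> S then p ! i - 1 else p ! i) < p ! i"
      by (intro bexI[of _ i]) auto
  qed auto
  also have "\<dots> = sum_list p"
    by (simp add: sum_list_sum_nth atLeast0LessThan)
  finally show ?thesis .
qed

lemma wf_is_option: "wf {(q, p). is_option p q}"
  by (rule wf_subset[OF wf_measure[of sum_list]]) (auto dest: is_option_sum_list_less)

lemma complete_play_singleton: "complete_play p [q] \<longleftrightarrow> q = p \<and> terminal p"
  by (auto simp: complete_play_def)

lemma complete_play_Cons2:
  "complete_play p (x # y # ps) \<longleftrightarrow> x = p \<and> is_option p y \<and> complete_play y (y # ps)"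
  by (auto simp: complete_play_def nth_Cons split: nat.splits)

lemma previous_follows_Cons3:
  "previous_follows \<sigma> (x # y # z # ps) \<longleftrightarrow> z = \<sigma> y \<and> previous_follows \<sigma> (z # ps)"
proof
  assume *: "previous_follows \<sigma> (x # y # z # ps)"
  have "z = \<sigma> y" using *[unfolded previous_follows_def, rule_format, of 1] by simp
  moreover have "previous_follows \<sigma> (z # ps)"
    unfolding previous_follows_def
    using *[unfolded previous_follows_def, rule_format, of "Suc (Suc _)"] by simp
  ultimately show "z = \<sigma> y \<and> previous_follows \<sigma> (z # ps)" by blast
next
  assume *: "z = \<sigma> y \<and> previous_follows \<sigma> (z # ps)"
  show "previous_follows \<sigma> (x # y # z # ps)"
    unfolding previous_follows_def
  proof (intro allI impI)
    fix i assume i: "odd i \<and> Suc i < length (x # y # z # ps)"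
    show "(x # y # z # ps) ! Suc i = \<sigma> ((x # y # z # ps) ! i)"
    proof (cases "i = 1")
      case True
      then show ?thesis using * by simp
    next
      case False
      with i obtain j where "i = Suc (Suc j)"
        by (metis One_nat_def not0_implies_Suc even_zero)
      with i * show ?thesis by (simp add: previous_follows_def)
    qed
  qed
qed

text \<open>\<^const>\<open>P_position\<close> is the only predicate satisfying the usual recursion.\<close>

lemma P_position_unique:
  assumes R: "\<And>p. R p \<longleftrightarrow> (\<forall>q. is_option p q \<longrightarrow> \<not> R q)"
  shows "P_position p \<longleftrightarrow> R p"
proof
  assume "R p"
  define \<sigma> where "\<sigma> q = (if \<exists>r. is_option q r \<and> R r
    then SOME r. is_option q r \<and> R r else SOME r. is_option q r)" for q
  have \<sigma>R: "is_option q (\<sigma> q) \<and> R (\<sigma> q)" if "\<not> R q" for q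
  proof -
    from that R have ex: "\<exists>r. is_option q r \<and> R r" by blast
    from someI_ex[OF this] ex show ?thesis by (simp add: \<sigma>_def)
  qed
  have "is_option q (\<sigma> q)" if "\<not> terminal q" for q
  proof (cases "R q")
    case True
    then have "\<not> (\<exists>r. is_option q r \<and> R r)" using R by blast
    then have "\<sigma> q = (SOME r. is_option q r)" unfolding \<sigma>_def by (rule if_not_P)
    moreover have "\<exists>r. is_option q r" using that by (simp add: terminal_def)
    ultimately show ?thesis by (metis someI_ex)
  qed (use \<sigma>R in blast)
  then have "strategy \<sigma>" by (simp add: strategy_def)
  moreover have "odd (length ps)"
    if "complete_play p ps" "previous_follows \<sigma> ps" "R p" for p ps
    using that
  proof (induction ps arbitrary: p rule: length_induct)
    case (1 ps)
    show ?case
    proof (cases ps)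
      case Nil
      then show ?thesis using 1 by (simp add: complete_play_def)
    next
      case (Cons x ps1)
      show ?thesis
      proof (cases ps1)
        case Nil
        then show ?thesis using Cons by simp
      next
        case ps1: (Cons y ps2)
        have y: "is_option p y" "complete_play y (y # ps2)"
          using 1 Cons ps1 by (simp_all add: complete_play_Cons2)
        with 1 R have "\<not> R y" by blast
        show ?thesis
        proof (cases ps2)
          case Nil
          then show ?thesis
            using y \<sigma>R[OF \<open>\<not> R y\<close>] by (auto simp: complete_play_singleton terminal_def)
        next
          case ps2: (Cons z ps3)
          have "z = \<sigma> y" "previous_follows \<sigma> (z # ps3)" "complete_play z (z # ps3)"
            using 1 y Cons ps1 ps2 by (auto simp: complete_play_Cons2 previous_follows_Cons3)
          then have "odd (length (z # ps3))"
            using 1(1)[rule_format, of "z # ps3" z] \<sigma>R[OF \<open>\<not> R y\<close>] Cons ps1 ps2 by simp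
          then show ?thesis using Cons ps1 ps2 by simp
        qed
      qed
    qed
  qed
  then have "\<forall>ps. complete_play p ps \<and> previous_follows \<sigma> ps \<longrightarrow> previous_wins ps"
    using \<open>R p\<close> by (auto simp: previous_wins_def)
  ultimately show "P_position p" unfolding P_position_def by blast
next
  assume "P_position p"
  then obtain \<sigma> where \<sigma>: "strategy \<sigma>"
    and win: "\<And>ps. complete_play p ps \<Longrightarrow> previous_follows \<sigma> ps \<Longrightarrow> previous_wins ps"
    unfolding P_position_def by blast
  have lose: "\<exists>ps. complete_play p (p # ps) \<and> previous_follows \<sigma> (p # ps) \<and> odd (length ps)"
    if "\<not> R p" for p
    using that
  proof (induction "sum_list p" arbitrary: p rule: less_induct)
    case less
    from less.prems R obtain q where q: "is_option p q" "R q" by blast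
    show ?case
    proof (cases "terminal q")
      case True
      with q show ?thesis
        by (intro exI[of _ "[q]"])
           (auto simp: complete_play_Cons2 complete_play_singleton previous_follows_def)
    next
      case False
      then have r: "is_option q (\<sigma> q)" using \<sigma> by (simp add: strategy_def)
      with q R have "\<not> R (\<sigma> q)" by blast
      moreover have "sum_list (\<sigma> q) < sum_list p"
        using is_option_sum_list_less[OF r] is_option_sum_list_less[OF q(1)] by simp
      ultimately obtain ps where "complete_play (\<sigma> q) (\<sigma> q # ps)"
        "previous_follows \<sigma> (\<sigma> q # ps)" "odd (length ps)"
        using less.hyps by blast
      with q r show ?thesis
        by (intro exI[of _ "q # \<sigma> q # ps"])
           (simp add: complete_play_Cons2 previous_follows_Cons3)
    qed
  qed
  show "R p"
  proof (rule ccontr)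
    assume "\<not> R p"
    from lose[OF this] obtain ps where ps: "complete_play p (p # ps)"
      "previous_follows \<sigma> (p # ps)" "odd (length ps)" by blast
    from win[OF ps(1,2)] ps(3) show False by (simp add: previous_wins_def)
  qed
qed

lemma P_position_iff: "P_position p \<longleftrightarrow> (\<forall>q. is_option p q \<longrightarrow> \<not> P_position q)"
proof -
  define R where "R = wfrec {(q, p). is_option p q} (\<lambda>f p. \<forall>q. is_option p q \<longrightarrow> \<not> f q)"
  have R: "R p \<longleftrightarrow> (\<forall>q. is_option p q \<longrightarrow> \<not> R q)" for p
    unfolding R_def by (subst wfrec[OF wf_is_option]) (simp add: cut_def)
  have "P_position q = R q" for q
    using R by (rule P_position_unique)
  with R[of p] show ?thesis by (simp only:)
qed

end

theory Submission
  imports Defs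
begin

text \<open>Having only even piles satisfies the recursion that determines \<open>P_position\<close>
  (\<open>P_position_unique\<close>). Any move from such a position leaves an odd pile
  (\<open>all_even_option_not_all_even\<close>); from any other position some move makes all piles
  even again (\<open>ex_option_all_even\<close>).\<close>

lemma all_even_option_not_all_even:
  assumes "\<forall>n \<in> set p. even n" and "is_option p q"
  shows "\<not> (\<forall>n \<in> set q. even n)"
proof -
  from assms(2) obtain S where S: "S \<noteq> {}" "S \<subseteq> {i. i < length p \<and> p ! i > 0}"
    and q: "q = map (\<lambda>i. if i \<in> S then p ! i - 1 else p ! i) [0..<length p]"
    unfolding is_option_def by blast
  from S obtain i where i: "i \<in> S" "i < length p" "p ! i > 0" by blast
  \<comment> \<open>Positivity of the pile matters: subtraction on naturals truncates, so
    \<open>0 - 1\<close> would be even.\<close>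
  have "odd (p ! i - 1)" using assms(1) i by simp
  moreover have "p ! i - 1 \<in> set q" using i by (force simp: q)
  ultimately show ?thesis by blast
qed

text \<open>The winning move takes one token from every odd pile. It is legal because odd piles are
  nonempty and at least one exists.\<close>

lemma ex_option_all_even:
  assumes "\<not> (\<forall>n \<in> set p. even n)"
  shows "\<exists>q. is_option p q \<and> (\<forall>n \<in> set q. even n)"
proof -
  define S where "S = {i. i < length p \<and> odd (p ! i)}"
  define q where "q = map (\<lambda>i. if i \<in> S then p ! i - 1 else p ! i) [0..<length p]"
  have "S \<noteq> {}" using assms by (auto simp: S_def in_set_conv_nth)
  moreover have "S \<subseteq> {i. i < length p \<and> p ! i > 0}" by (auto simp: S_def odd_pos)
  ultimately have "is_option p q" unfolding is_option_def q_def by blast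
  moreover have "\<forall>n \<in> set q. even n" by (auto simp: q_def S_def)
  ultimately show ?thesis by blast
qed

theorem proposition1p2:
  fixes p :: position
  shows "P_position p \<longleftrightarrow> (\<forall>n \<in> set p. even n)"
proof (rule P_position_unique)
  fix p :: position
  show "(\<forall>n \<in> set p. even n) \<longleftrightarrow> (\<forall>q. is_option p q \<longrightarrow> \<not> (\<forall>n \<in> set q. even n))"
    \<comment> \<open>Terminal positions need no separate case: with no option available,
      \<open>ex_option_all_even\<close> forces all piles to be even.\<close>
    using all_even_option_not_all_even ex_option_all_even by blast
qed

end
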